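(* Let $T: X \rightrightarrows X^*$ be maximal monotone, and let $\{x^k\}_{k=0}^\infty \subseteq X$, $\{v^k\}_{k=0}^\infty \subseteq X^*$ be the sequences generated by the anisotropic proximal point algorithm (with unit relaxation parameter), i.e. satisfying, for all $k \geq 0$, $v^k \in T(x^{k+1})$ and $x^{k+1} = x^k - \nabla \phi^*(v^k)$. Then the following hold: (i) Suppose that $\{x^k\}_{k=0}^\infty$ has a limit point (i.e. some subsequence converges). Then $\lim_{k \to \infty} v^k = 0$. (ii) Every limit point of the sequence $\{x^k\}_{k=0}^\infty$ is a zero of $T$, i.e. a point $x \in X$ with $0 \in T(x)$.
   Context: $X$ is a Euclidean space, $X^* = X$ its dual, with pairing $\langle\cdot,\cdot\rangle$ the Euclidean inner product. The prox-function $\phi: X \to \mathbb{R}$ is strictly convex, smooth and super-coercive (i.e. $\phi(x)/\|x\| \to \infty$ as $\|x\|\to\infty$), with $\nabla\phi(0)=0$. Its convex conjugate $\phi^*: X^* \to \mathbb{R}$ then has the same properties, $\nabla \phi: X \to X^*$ is a bijection with inverse $\nabla\phi^*$, and $\nabla\phi^*(0)=0$. A set-valued mapping $T:X\rightrightarrows X^*$ is monotone if $\langle x-y,x^*-y^*\rangle \ge 0$ for all $(x,x^* ),(y,y^* )$ in its graph $\{(x,x^* ) : x^* \in T(x)\}$, and maximal monotone if its graph is not strictly contained in the graph of another monotone mapping. *)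

theory Defs
  imports "HOL-Analysis.Analysis"
begin

definition strictly_convex :: "('a::real_vector \<Rightarrow> real) \<Rightarrow> bool" where
  "strictly_convex f \<longleftrightarrow>
     (\<forall>x y u v. x \<noteq> y \<and> 0 < u \<and> 0 < v \<and> u + v = 1 \<longrightarrow>
        f (u *\<^sub>R x + v *\<^sub>R y) < u * f x + v * f y)"

(* Smoothness in the sense of convex analysis: a gradient exists at every point.
   A finite convex function on a Euclidean space with this property is automatically
   continuously differentiable. Infinite differentiability is not meant: it is not
   inherited by the convex conjugate (take f x = x ^ 4). *)
definition smooth :: "('a::real_inner \<Rightarrow> real) \<Rightarrow> bool" where
  "smooth f \<longleftrightarrow> (\<forall>x. f differentiable (at x))"

definition super_coercive :: "('a::real_normed_vector \<Rightarrow> real) \<Rightarrow> bool" where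
  "super_coercive f \<longleftrightarrow> filterlim (\<lambda>x. f x / norm x) at_top at_infinity"

(* Meaningful only at points where f is differentiable. *)
definition gradient :: "('a::real_inner \<Rightarrow> real) \<Rightarrow> 'a \<Rightarrow> 'a" where
  "gradient f x = (THE g. GDERIV f x :> g)"

(* The supremum is taken in the reals, so it is the true conjugate only where the family
   is bounded above. For continuous super-coercive f on a Euclidean space this is everywhere. *)
definition conjugate :: "('a::real_inner \<Rightarrow> real) \<Rightarrow> 'a \<Rightarrow> real" where
  "conjugate f y = (SUP x. x \<bullet> y - f x)"

definition map_graph :: "('a \<Rightarrow> 'b set) \<Rightarrow> ('a \<times> 'b) set" where
  "map_graph T = {(x, y). y \<in> T x}"

definition monotone_map :: "('a::real_inner \<Rightarrow> 'a set) \<Rightarrow> bool" where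
  "monotone_map T \<longleftrightarrow>
     (\<forall>(x, x')\<in>map_graph T. \<forall>(y, y')\<in>map_graph T. 0 \<le> (x - y) \<bullet> (x' - y'))"

definition maximal_monotone :: "('a::real_inner \<Rightarrow> 'a set) \<Rightarrow> bool" where
  "maximal_monotone T \<longleftrightarrow>
     monotone_map T \<and> \<not> (\<exists>S. monotone_map S \<and> map_graph T \<subset> map_graph S)"

(* Limit of a subsequence. This differs from islimpt applied to the range of the sequence,
   which fails, for instance, for constant sequences. *)
definition seq_limit_point :: "(nat \<Rightarrow> 'a::topological_space) \<Rightarrow> 'a \<Rightarrow> bool" where
  "seq_limit_point x l \<longleftrightarrow> (\<exists>r. strict_mono r \<and> (x \<circ> r) \<longlonglongrightarrow> l)"

end

(* Write D = grad phi^*. Monotonicity gives <D(v^{k+1}), v^k - v^{k+1}> >= 0, so phi^*(v^k)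
   decreases and (v^k) is bounded; strict convexity of phi^* forces v^{k+1} to have the same
   limit as v^k along subsequences. If x^{k_j} -> l and v^{k_j} -> w, then for every fixed i
   x^{k_j+i} -> l - i D(w) and v^{k_j+i} -> w. Monotonicity between (x^{k+1}, v^k) and these
   limits, divided by i -> infinity, yields <D(w), v^k - w> >= 0 for all k. As all limit points
   of v share the value of phi^*, strict convexity makes w the only one, so v^k -> w and the
   increments of x converge to -D(w). A limit point of x excludes such a drift unless w = 0.
   The second claim is the closedness of the graph of T. *)
theory Submission
  imports Defs
begin

section \<open>Gradients, subsequential limits and maximal monotonicity\<close>

text \<open>Coordinates in \<open>Basis\<close> represent the derivative as an inner product;
  uniqueness of derivatives makes the \<open>THE\<close> in \<open>gradient\<close> well
  defined.\<close>

lemma GDERIV_iff_gradient: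
  fixes f :: "'a::euclidean_space \<Rightarrow> real"
  assumes "f differentiable (at x)"
  shows "GDERIV f x :> gradient f x"
proof -
  obtain f' where f': "(f has_derivative f') (at x)"
    using assms unfolding differentiable_def by blast
  interpret f': linear f'
    using f' by (rule has_derivative_linear)
  define g where "g = (\<Sum>b\<in>Basis. f' b *\<^sub>R b)"
  have "f' h = h \<bullet> g" for h
  proof -
    have "f' h = f' (\<Sum>b\<in>Basis. (h \<bullet> b) *\<^sub>R b)"
      by (simp add: euclidean_representation)
    also have "\<dots> = h \<bullet> g"
      by (simp add: f'.sum f'.scale g_def inner_sum_right mult.commute)
    finally show ?thesis .
  qed
  then have "f' = (\<lambda>h. h \<bullet> g)"
    by auto
  then have g: "GDERIV f x :> g"
    using f' by (simp add: gderiv_def)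
  moreover have "g' = g" if "GDERIV f x :> g'" for g'
  proof -
    have "(\<lambda>h. h \<bullet> g') = (\<lambda>h. h \<bullet> g)"
      using that g unfolding gderiv_def by (rule has_derivative_unique)
    then show ?thesis
      by (metis vector_eq_ldot)
  qed
  ultimately show ?thesis
    unfolding gradient_def by (rule theI)
qed

lemma gradient_eqI:
  fixes f :: "'a::euclidean_space \<Rightarrow> real"
  assumes "GDERIV f x :> g"
  shows "gradient f x = g"
proof -
  have "GDERIV f x :> gradient f x"
    using assms by (intro GDERIV_iff_gradient) (auto simp: gderiv_def differentiable_def)
  then have "(\<lambda>h. h \<bullet> gradient f x) = (\<lambda>h. h \<bullet> g)"
    using assms unfolding gderiv_def by (rule has_derivative_unique)
  then show ?thesis
    by (metis vector_eq_ldot)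
qed

text \<open>Otherwise infinitely many terms stay away from \<open>w\<close>, and by boundedness some
  subsequence of these has a limit other than \<open>w\<close>.\<close>

lemma tendsto_if_unique_seq_limit_point:
  fixes v :: "nat \<Rightarrow> 'a::heine_borel"
  assumes "bounded (range v)"
    and "\<And>l. seq_limit_point v l \<Longrightarrow> l = w"
  shows "v \<longlonglongrightarrow> w"
proof (rule ccontr)
  assume "\<not> v \<longlonglongrightarrow> w"
  then obtain e where "e > 0" and e: "\<exists>\<^sub>F n in sequentially. dist (v n) w \<ge> e"
    by (auto simp: tendsto_iff frequently_def not_le)
  then have "infinite {n. dist (v n) w \<ge> e}"
    using frequently_cofinite cofinite_eq_sequentially by metis
  then obtain r :: "nat \<Rightarrow> nat" where r: "strict_mono r" "\<And>n. dist (v (r n)) w \<ge> e"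
    using infinite_enumerate by blast
  have "bounded (range (v \<circ> r))"
    using assms(1) by (rule bounded_subset) auto
  then obtain l s where s: "strict_mono s" "((v \<circ> r) \<circ> s) \<longlonglongrightarrow> l"
    using bounded_imp_convergent_subsequence by blast
  have "seq_limit_point v l"
    unfolding seq_limit_point_def
    by (rule exI[of _ "r \<circ> s"]) (use r s in \<open>auto intro: strict_mono_o simp: o_assoc\<close>)
  then have "l = w"
    by (rule assms(2))
  then have "(\<lambda>n. dist (v (r (s n))) w) \<longlonglongrightarrow> dist w w"
    using s(2) by (intro tendsto_dist tendsto_const) (simp add: o_def)
  then have "e \<le> dist w w"
    by (rule tendsto_lowerbound) (use r(2) in auto)
  then show False
    using \<open>e > 0\<close> by simp
qed

text \<open>Adjoining \<open>(l, u)\<close> to the graph would otherwise give a strictly larger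
  monotone graph.\<close>

lemma maximal_monotoneD:
  assumes "maximal_monotone T"
    and rel: "\<And>y y'. y' \<in> T y \<Longrightarrow> 0 \<le> (y - l) \<bullet> (y' - u)"
  shows "u \<in> T l"
proof (rule ccontr)
  assume u: "u \<notin> T l"
  define S where "S = T(l := insert u (T l))"
  have S: "map_graph S = insert (l, u) (map_graph T)"
    by (auto simp: S_def map_graph_def split: if_splits)
  have mono: "monotone_map T"
    using assms(1) by (simp add: maximal_monotone_def)
  have rel': "0 \<le> (l - y) \<bullet> (u - y')" if "y' \<in> T y" for y y'
    using rel[OF that] by (simp add: inner_diff_left inner_diff_right)
  have "monotone_map S"
    using mono rel rel' unfolding monotone_map_def S
    by (auto simp: map_graph_def)
  moreover have "map_graph T \<subset> map_graph S"
    using u unfolding S by (auto simp: map_graph_def)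
  ultimately show False
    using assms(1) by (auto simp: maximal_monotone_def)
qed

section \<open>Prox-functions: growth and attainment in the conjugate\<close>

locale prox_function =
  fixes \<phi> :: "'a::euclidean_space \<Rightarrow> real"
  assumes strictly_convex: "strictly_convex \<phi>"
    and smooth: "smooth \<phi>"
    and super_coercive: "super_coercive \<phi>"
begin

lemma continuous: "continuous_on S \<phi>"
  using smooth unfolding smooth_def
  by (meson continuous_at_imp_continuous_on differentiable_imp_continuous_within)

lemma super_coercive_bound:
  obtains R where "R > 0" "\<And>z. R \<le> norm z \<Longrightarrow> C * norm z \<le> \<phi> z"
proof -
  have "\<forall>\<^sub>F z in at_infinity. C \<le> \<phi> z / norm z"
    using super_coercive by (simp add: super_coercive_def filterlim_at_top)
  then obtain b where b: "\<And>z. b \<le> norm z \<Longrightarrow> C \<le> \<phi> z / norm z"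
    by (auto simp: eventually_at_infinity)
  show thesis
  proof
    show "max b 1 > 0" by simp
    show "C * norm z \<le> \<phi> z" if "max b 1 \<le> norm z" for z
    proof -
      have "norm z > 0" "b \<le> norm z"
        using that by auto
      then show ?thesis
        using b[of z] by (simp add: pos_le_divide_eq)
    qed
  qed
qed

text \<open>The objective equals \<open>- \<phi> 0\<close> at \<open>z = 0\<close>, so this
  superlevel set contains every maximizer. Uniformity in \<open>v\<close> serves the continuity of
  \<open>dual_gradient\<close>.\<close>

lemma superlevel_bound:
  obtains B where "B > 0"
    "\<And>z v. norm v \<le> M \<Longrightarrow> - \<phi> 0 \<le> z \<bullet> v - \<phi> z \<Longrightarrow> norm z \<le> B"
proof -
  \<comment> \<open>Slope \<open>M + 1\<close> beats the Cauchy-Schwarz slope \<open>M\<close> by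
    one, which leaves \<open>norm z \<le> \<phi> 0\<close>.\<close>
  obtain R where R: "R > 0" "\<And>z. R \<le> norm z \<Longrightarrow> (M + 1) * norm z \<le> \<phi> z"
    using super_coercive_bound by blast
  show thesis
  proof
    show "max R (\<phi> 0) > 0" using R(1) by simp
    fix z v
    assume v: "norm v \<le> M" and z: "- \<phi> 0 \<le> z \<bullet> v - \<phi> z"
    show "norm z \<le> max R (\<phi> 0)"
    proof (cases "R \<le> norm z")
      case True
      have "z \<bullet> v \<le> norm z * norm v"
        by (rule norm_cauchy_schwarz)
      also have "\<dots> \<le> norm z * M"
        using v by (rule mult_left_mono) simp
      finally show ?thesis
        using R(2)[OF True] z by (simp add: algebra_simps)
    qed simp
  qed
qed

text \<open>Attainment in the supremum defining \<open>conjugate \<phi> v\<close>; equivalently,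
  \<open>v\<close> is a subgradient of \<open>\<phi>\<close> at \<open>d\<close>.\<close>

definition maximizes :: "'a \<Rightarrow> 'a \<Rightarrow> bool" where
  "maximizes d v \<longleftrightarrow> (\<forall>z. z \<bullet> v - \<phi> z \<le> d \<bullet> v - \<phi> d)"

text \<open>Compactness gives a maximizer on a ball; outside it the objective lies below its value
  at \<open>0\<close>.\<close>

lemma maximizes_exists: "\<exists>d. maximizes d v"
proof -
  obtain B where B: "B > 0" "\<And>z. - \<phi> 0 \<le> z \<bullet> v - \<phi> z \<Longrightarrow> norm z \<le> B"
    using superlevel_bound[of "norm v"] by (metis order_refl)
  have "\<exists>d\<in>cball 0 B. \<forall>z\<in>cball 0 B. z \<bullet> v - \<phi> z \<le> d \<bullet> v - \<phi> d"
    using B(1) by (intro continuous_attains_sup continuous_intros continuous) auto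
  then obtain d where d: "\<And>z. norm z \<le> B \<Longrightarrow> z \<bullet> v - \<phi> z \<le> d \<bullet> v - \<phi> d"
    by (metis mem_cball_0)
  have "z \<bullet> v - \<phi> z \<le> d \<bullet> v - \<phi> d" for z
  proof (cases "norm z \<le> B")
    case False
    then have "z \<bullet> v - \<phi> z \<le> - \<phi> 0"
      using B(2)[of z] by linarith
    then show ?thesis
      using d[of 0] B(1) by simp
  qed (rule d)
  then show ?thesis
    by (auto simp: maximizes_def)
qed

text \<open>The midpoint of two distinct maximizers would do strictly better.\<close>

lemma maximizes_unique:
  assumes "maximizes d v" "maximizes e v"
  shows "d = e"
proof (rule ccontr)
  assume "d \<noteq> e"
  define m where "m = (1/2) *\<^sub>R d + (1/2) *\<^sub>R e"
  have "\<phi> m < (1/2) * \<phi> d + (1/2) * \<phi> e"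
    using strictly_convex \<open>d \<noteq> e\<close> unfolding strictly_convex_def m_def
    by (metis field_sum_of_halves half_gt_zero_iff zero_less_one)
  moreover have "m \<bullet> v = (1/2) * (d \<bullet> v) + (1/2) * (e \<bullet> v)"
    by (simp add: m_def inner_add_left)
  moreover have "m \<bullet> v - \<phi> m \<le> d \<bullet> v - \<phi> d" "m \<bullet> v - \<phi> m \<le> e \<bullet> v - \<phi> e"
    using assms by (auto simp: maximizes_def)
  ultimately show False
    by linarith
qed

text \<open>Shown in \<open>gradient_conjugate\<close> to be the gradient of the conjugate; as a
  maximizer it is usable before differentiability is known.\<close>

definition dual_gradient :: "'a \<Rightarrow> 'a" where
  "dual_gradient v = (THE d. maximizes d v)"

lemma dual_gradient: "maximizes (dual_gradient v) v"
  unfolding dual_gradient_def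
  using maximizes_exists maximizes_unique by (metis theI)

lemma dual_gradient_eqI: "maximizes d v \<Longrightarrow> dual_gradient v = d"
  using dual_gradient maximizes_unique by blast

lemma conjugate_eq: "conjugate \<phi> v = dual_gradient v \<bullet> v - \<phi> (dual_gradient v)"
  unfolding conjugate_def
  by (rule cSup_eq_maximum) (use dual_gradient[of v] in \<open>auto simp: maximizes_def\<close>)

lemma Fenchel_Young: "z \<bullet> v - \<phi> z \<le> conjugate \<phi> v"
  using dual_gradient[of v] by (simp add: conjugate_eq maximizes_def)

lemma maximizes_iff: "maximizes d v \<longleftrightarrow> conjugate \<phi> v \<le> d \<bullet> v - \<phi> d"
proof
  assume "maximizes d v"
  then show "conjugate \<phi> v \<le> d \<bullet> v - \<phi> d"
    by (simp add: conjugate_eq maximizes_def)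
next
  assume "conjugate \<phi> v \<le> d \<bullet> v - \<phi> d"
  then show "maximizes d v"
    using Fenchel_Young order_trans by (fastforce simp: maximizes_def)
qed

text \<open>Fenchel-Young at \<open>w\<close>, tested with the maximizer for
  \<open>v\<close>.\<close>

lemma dual_gradient_subgradient:
  "conjugate \<phi> v + dual_gradient v \<bullet> (w - v) \<le> conjugate \<phi> w"
  using Fenchel_Young[of "dual_gradient v" w] conjugate_eq[of v]
  by (simp add: inner_diff_right)

section \<open>Strict convexity and differentiability of the conjugate\<close>

text \<open>Fermat's rule for the maximum of \<open>z \<bullet> v - \<phi> z\<close> at
  \<open>z = d\<close>.\<close>

lemma maximizes_has_derivative:
  assumes "maximizes d v"
  shows "(\<phi> has_derivative (\<lambda>h. h \<bullet> v)) (at d)"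
proof -
  obtain f' where f': "(\<phi> has_derivative f') (at d)"
    using smooth by (auto simp: smooth_def differentiable_def)
  then have "((\<lambda>z. z \<bullet> v - \<phi> z) has_derivative (\<lambda>h. h \<bullet> v - f' h)) (at d)"
    by (auto intro!: derivative_eq_intros)
  then have "(\<lambda>h. h \<bullet> v - f' h) = (\<lambda>h. 0)"
    using assms by (intro differential_zero_maxmin[of d UNIV]) (auto simp: maximizes_def)
  then have "f' = (\<lambda>h. h \<bullet> v)"
    by (auto simp: fun_eq_iff)
  then show ?thesis
    using f' by simp
qed

text \<open>The maximizer determines \<open>v\<close>, which is the derivative of
  \<open>\<phi>\<close> there.\<close>

lemma dual_gradient_inj: "dual_gradient v = dual_gradient w \<Longrightarrow> v = w"
proof -
  assume "dual_gradient v = dual_gradient w"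
  then have "(\<lambda>h. h \<bullet> v) = (\<lambda>h. h \<bullet> w)"
    using maximizes_has_derivative[OF dual_gradient] has_derivative_unique by metis
  then show ?thesis
    by (metis vector_eq_ldot)
qed

text \<open>Strict convexity of the conjugate, which comes from the differentiability of \<open>\<phi>\<close>.\<close>

lemma dual_gradient_subgradient_eq:
  assumes "conjugate \<phi> w \<le> conjugate \<phi> v + dual_gradient v \<bullet> (w - v)"
  shows "w = v"
proof -
  \<comment> \<open>Equality in the subgradient inequality makes the maximizer for \<open>v\<close>
    one for \<open>w\<close> too.\<close>
  have "maximizes (dual_gradient v) w"
    using assms conjugate_eq[of v] by (simp add: maximizes_iff inner_diff_right)
  then show ?thesis
    using dual_gradient_eqI dual_gradient_inj by blast
qed

text \<open>Maximizers for points near \<open>v\<close> stay in a fixed compact ball, so a closed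
  graph suffices.\<close>

lemma isCont_dual_gradient: "isCont dual_gradient v"
proof -
  obtain B where B: "B > 0"
    "\<And>z w. norm w \<le> norm v + 1 \<Longrightarrow> - \<phi> 0 \<le> z \<bullet> w - \<phi> z \<Longrightarrow> norm z \<le> B"
    using superlevel_bound[of "norm v + 1"] by blast
  have "continuous_on (cball v 1) dual_gradient"
  proof (rule continuous_from_closed_graph[of "cball 0 B"])
    show "dual_gradient \<in> cball v 1 \<rightarrow> cball 0 B"
    proof
      fix w assume "w \<in> cball v 1"
      then have "norm (w - v) \<le> 1"
        by (simp add: dist_norm norm_minus_commute)
      then have "norm w \<le> norm v + 1"
        using norm_triangle_sub[of w v] by linarith
      moreover have "- \<phi> 0 \<le> dual_gradient w \<bullet> w - \<phi> (dual_gradient w)"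
        using Fenchel_Young[of 0 w] by (simp add: conjugate_eq)
      ultimately show "dual_gradient w \<in> cball 0 B"
        using B(2) by simp
    qed
    \<comment> \<open>Maximizers being unique, the graph is cut out by one closed inequality per
      test point \<open>z\<close>.\<close>
    have "(\<lambda>w. (w, dual_gradient w)) ` cball v 1 =
        (cball v 1 \<times> UNIV) \<inter>
        (\<Inter>z. {p. z \<bullet> fst p - \<phi> z \<le> snd p \<bullet> fst p - \<phi> (snd p)})"
    proof -
      have "d = dual_gradient w \<longleftrightarrow> (\<forall>z. z \<bullet> w - \<phi> z \<le> d \<bullet> w - \<phi> d)" for w d
        using dual_gradient dual_gradient_eqI by (metis maximizes_def)
      then show ?thesis
        by (simp add: set_eq_iff image_iff)
    qed
    moreover have "closed \<dots>"
      by (intro closed_Int closed_Times closed_INT ballI closed_Collect_le continuous_intros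
          continuous_on_compose2[OF continuous[of UNIV]]) auto
    ultimately show "closed ((\<lambda>w. (w, dual_gradient w)) ` cball v 1)"
      by simp
  qed simp
  then have "continuous_on (ball v 1) dual_gradient"
    by (rule continuous_on_subset) auto
  then show ?thesis
    by (simp add: continuous_on_eq_continuous_at)
qed

text \<open>The subgradient inequalities at \<open>v\<close> and at \<open>w\<close> sandwich the first-order error at \<open>v\<close>
  between \<open>0\<close> and \<open>norm (dual_gradient w - dual_gradient v) * norm (w - v)\<close>.\<close>

lemma conjugate_GDERIV: "GDERIV (conjugate \<phi>) v :> dual_gradient v"
  unfolding gderiv_def has_derivative_at2
proof (intro conjI bounded_linear_inner_left)
  let ?D = dual_gradient
  have "((\<lambda>w. norm (?D w - ?D v)) \<longlongrightarrow> norm (?D v - ?D v)) (at v)"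
    using isCont_dual_gradient[of v] unfolding isCont_def by (intro tendsto_intros)
  then have lim: "((\<lambda>w. norm (?D w - ?D v)) \<longlongrightarrow> 0) (at v)"
    by simp
  have "norm ((1 / norm (w - v)) *\<^sub>R (conjugate \<phi> w - (conjugate \<phi> v + (w - v) \<bullet> ?D v)))
      \<le> norm (?D w - ?D v)" if "w \<noteq> v" for w
  proof -
    have "0 \<le> conjugate \<phi> w - (conjugate \<phi> v + (w - v) \<bullet> ?D v)"
      using dual_gradient_subgradient[of v w] by (simp add: inner_commute)
    moreover have "conjugate \<phi> w - (conjugate \<phi> v + (w - v) \<bullet> ?D v) \<le> (?D w - ?D v) \<bullet> (w - v)"
      using dual_gradient_subgradient[of w v]
      by (simp add: inner_diff_left inner_diff_right inner_commute)
    moreover have "\<dots> \<le> norm (?D w - ?D v) * norm (w - v)"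
      by (rule norm_cauchy_schwarz)
    ultimately show ?thesis
      using that by (simp add: divide_le_eq)
  qed
  then show "((\<lambda>w. (1 / norm (w - v)) *\<^sub>R (conjugate \<phi> w - (conjugate \<phi> v + (w - v) \<bullet> ?D v)))
      \<longlongrightarrow> 0) (at v)"
    by (intro Lim_null_comparison[OF _ lim]) (auto simp: eventually_at_filter)
qed

lemma gradient_conjugate: "gradient (conjugate \<phi>) v = dual_gradient v"
  by (rule gradient_eqI) (rule conjugate_GDERIV)

lemma isCont_conjugate: "isCont (conjugate \<phi>) v"
  using conjugate_GDERIV[of v] has_derivative_continuous unfolding gderiv_def by blast

text \<open>Fenchel-Young at \<open>sgn v\<close> bounds the conjugate below by
  \<open>norm v\<close> minus the maximum of \<open>\<bar>\<phi>\<bar>\<close> on the unit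
  ball.\<close>

lemma bounded_conjugate_sublevel: "bounded {v. conjugate \<phi> v \<le> c}"
proof -
  have "compact (\<phi> ` cball 0 1)"
    by (intro compact_continuous_image continuous) auto
  then obtain K where K: "\<And>z. norm z \<le> 1 \<Longrightarrow> \<bar>\<phi> z\<bar> \<le> K"
    by (metis bounded_iff compact_imp_bounded image_eqI mem_cball_0 real_norm_def)
  have "norm v \<le> c + K" if "conjugate \<phi> v \<le> c" for v
  proof -
    have "sgn v \<bullet> v = norm v"
      by (cases "v = 0") (simp_all add: sgn_div_norm dot_square_norm power2_eq_square)
    moreover have "\<bar>\<phi> (sgn v)\<bar> \<le> K"
      by (rule K) (simp add: norm_sgn)
    ultimately show ?thesis
      using Fenchel_Young[of "sgn v" v] that by simp
  qed
  then show ?thesis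
    by (auto simp: bounded_iff)
qed

text \<open>A critical point of a convex function is a global minimizer; this is checked on each
  line through \<open>0\<close> with the horizontal tangent there.\<close>

lemma dual_gradient_zero:
  assumes "gradient \<phi> 0 = 0"
  shows "dual_gradient 0 = 0"
proof (rule dual_gradient_eqI)
  have "\<phi> differentiable (at 0)"
    using smooth by (simp add: smooth_def)
  then have "GDERIV \<phi> 0 :> gradient \<phi> 0"
    by (rule GDERIV_iff_gradient)
  then have der0: "(\<phi> has_derivative (\<lambda>h. 0)) (at 0)"
    by (simp add: gderiv_def assms)
  have "\<phi> 0 \<le> \<phi> z" for z
  proof -
    have convex: "convex_on UNIV (\<lambda>t. \<phi> (t *\<^sub>R z))"
    proof (rule convex_onI)
      fix t a b :: real
      assume t: "0 < t" "t < 1"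
      have eq: "((1 - t) *\<^sub>R a + t *\<^sub>R b) *\<^sub>R z = (1 - t) *\<^sub>R (a *\<^sub>R z) + t *\<^sub>R (b *\<^sub>R z)"
        by (simp add: scaleR_add_left)
      show "\<phi> (((1 - t) *\<^sub>R a + t *\<^sub>R b) *\<^sub>R z)
          \<le> (1 - t) * \<phi> (a *\<^sub>R z) + t * \<phi> (b *\<^sub>R z)"
      proof (cases "a *\<^sub>R z = b *\<^sub>R z")
        case True
        then show ?thesis
          by (simp only: eq True scaleR_collapse) (simp add: algebra_simps)
      next
        case False
        then show ?thesis
          using strictly_convex[unfolded strictly_convex_def, rule_format,
              of "a *\<^sub>R z" "b *\<^sub>R z" "1 - t" t] t
          unfolding eq by simp
      qed
    qed simp
    have "((\<lambda>t. \<phi> (t *\<^sub>R z)) has_derivative (\<lambda>h. 0)) (at 0)"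
      using der0 by (intro has_derivative_compose[of "\<lambda>t. t *\<^sub>R z" "\<lambda>t. t *\<^sub>R z" 0 UNIV \<phi>])
        (auto intro!: derivative_eq_intros)
    then have "((\<lambda>t. \<phi> (t *\<^sub>R z)) has_real_derivative 0) (at 0)"
      by (rule has_derivative_imp_has_field_derivative) simp
    then show ?thesis
      using convex_on_imp_above_tangent[OF convex, of 0 1 0] by simp
  qed
  then show "maximizes 0 0"
    by (simp add: maximizes_def)
qed

end

locale anisotropic_ppa = prox_function \<phi> for \<phi> :: "'a::euclidean_space \<Rightarrow> real" +
  fixes x v :: "nat \<Rightarrow> 'a"
  assumes gradient_zero: "gradient \<phi> 0 = 0"
    and monotone: "0 \<le> (x (Suc j) - x (Suc k)) \<bullet> (v j - v k)"
    and step: "x (Suc k) = x k - dual_gradient (v k)"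
begin

lemma dual_gradient_diff_nonneg: "0 \<le> dual_gradient (v (Suc k)) \<bullet> (v k - v (Suc k))"
  using monotone[of k "Suc k"] step[of "Suc k"] by simp

lemma conjugate_decseq: "decseq (\<lambda>k. conjugate \<phi> (v k))"
  unfolding decseq_Suc_iff
  using dual_gradient_subgradient[of "v (Suc k)" "v k" for k] dual_gradient_diff_nonneg
  by (smt (verit))

lemma bounded_v: "bounded (range v)"
proof (rule bounded_subset[OF bounded_conjugate_sublevel])
  show "range v \<subseteq> {w. conjugate \<phi> w \<le> conjugate \<phi> (v 0)}"
    using conjugate_decseq by (auto simp: decseq_def)
qed

lemma conjugate_limit:
  assumes "seq_limit_point v w"
  shows "(\<lambda>k. conjugate \<phi> (v k)) \<longlonglongrightarrow> conjugate \<phi> w"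
proof -
  have bound: "- \<phi> 0 \<le> conjugate \<phi> (v k)" for k
    using Fenchel_Young[of 0 "v k"] by simp
  obtain c where c: "(\<lambda>k. conjugate \<phi> (v k)) \<longlonglongrightarrow> c"
    using decseq_convergent[OF conjugate_decseq] bound by metis
  obtain r where r: "strict_mono r" "(v \<circ> r) \<longlonglongrightarrow> w"
    using assms by (auto simp: seq_limit_point_def)
  have "(\<lambda>k. conjugate \<phi> ((v \<circ> r) k)) \<longlonglongrightarrow> conjugate \<phi> w"
    using isCont_conjugate r(2) by (rule isCont_tendsto_compose)
  moreover have "(\<lambda>k. conjugate \<phi> ((v \<circ> r) k)) \<longlonglongrightarrow> c"
    using LIMSEQ_subseq_LIMSEQ[OF c r(1)] by (simp add: o_def)
  ultimately show ?thesis
    using c LIMSEQ_unique by blast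
qed

lemma limit_points_conjugate_eq:
  assumes "seq_limit_point v w" "seq_limit_point v w'"
  shows "conjugate \<phi> w = conjugate \<phi> w'"
  using assms conjugate_limit LIMSEQ_unique by blast

lemma v_shift_limit:
  assumes r: "strict_mono r" and lim: "(\<lambda>j. v (r j)) \<longlonglongrightarrow> w"
  shows "(\<lambda>j. v (Suc (r j))) \<longlonglongrightarrow> w"
proof (rule tendsto_if_unique_seq_limit_point)
  show "bounded (range (\<lambda>j. v (Suc (r j))))"
    using bounded_v by (rule bounded_subset) auto
  fix w' assume "seq_limit_point (\<lambda>j. v (Suc (r j))) w'"
  then obtain s where s: "strict_mono s" and w': "(\<lambda>j. v (Suc (r (s j)))) \<longlonglongrightarrow> w'"
    by (auto simp: seq_limit_point_def o_def)
  have "seq_limit_point v w'"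
    unfolding seq_limit_point_def
    by (rule exI[of _ "\<lambda>j. Suc (r (s j))"]) (use r s w' in \<open>auto simp: strict_mono_def o_def\<close>)
  moreover have "seq_limit_point v w"
    using assms by (auto simp: seq_limit_point_def o_def)
  ultimately have eq: "conjugate \<phi> w = conjugate \<phi> w'"
    using limit_points_conjugate_eq by blast
  have w: "(\<lambda>j. v (r (s j))) \<longlonglongrightarrow> w"
    using LIMSEQ_subseq_LIMSEQ[OF lim s] by (simp add: o_def)
  have "(\<lambda>j. dual_gradient (v (Suc (r (s j)))) \<bullet> (v (r (s j)) - v (Suc (r (s j)))))
      \<longlonglongrightarrow> dual_gradient w' \<bullet> (w - w')"
    by (intro tendsto_intros w w' isCont_tendsto_compose[OF isCont_dual_gradient])
  then have "0 \<le> dual_gradient w' \<bullet> (w - w')"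
    by (rule tendsto_lowerbound) (auto simp: dual_gradient_diff_nonneg)
  then show "w' = w"
    using dual_gradient_subgradient_eq[of w w'] eq by simp
qed

lemma shifted_limits:
  assumes r: "strict_mono r" and x: "(\<lambda>j. x (r j)) \<longlonglongrightarrow> l" and v: "(\<lambda>j. v (r j)) \<longlonglongrightarrow> w"
  shows "(\<lambda>j. v (r j + i)) \<longlonglongrightarrow> w \<and> (\<lambda>j. x (r j + i)) \<longlonglongrightarrow> l - real i *\<^sub>R dual_gradient w"
proof (induction i)
  case 0
  show ?case using x v by simp
next
  case (Suc i)
  then have v': "(\<lambda>j. v (r j + i)) \<longlonglongrightarrow> w"
    and x': "(\<lambda>j. x (r j + i)) \<longlonglongrightarrow> l - real i *\<^sub>R dual_gradient w"
    by auto
  have "(\<lambda>j. v (Suc (r j + i))) \<longlonglongrightarrow> w"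
    by (rule v_shift_limit[OF _ v']) (use r in \<open>auto simp: strict_mono_def\<close>)
  moreover have "(\<lambda>j. x (r j + i) - dual_gradient (v (r j + i)))
      \<longlonglongrightarrow> (l - real i *\<^sub>R dual_gradient w) - dual_gradient w"
    by (intro tendsto_intros v' x' isCont_tendsto_compose[OF isCont_dual_gradient])
  ultimately show ?case
    by (simp add: step algebra_simps)
qed

text \<open>The limits of the shifted iterates form a ray in direction \<open>- dual_gradient w\<close> on which
  the operator takes the value \<open>w\<close>; monotonicity against points far out on this ray gives the
  inequality.\<close>

lemma recession_inequality:
  assumes "strict_mono r" "(\<lambda>j. x (r j)) \<longlonglongrightarrow> l" "(\<lambda>j. v (r j)) \<longlonglongrightarrow> w"
  shows "0 \<le> dual_gradient w \<bullet> (v k - w)"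
proof -
  let ?d = "dual_gradient w"
  have ray: "0 \<le> (x (Suc k) - l) \<bullet> (v k - w) + real (Suc i) * (?d \<bullet> (v k - w))" for i
  proof -
    have "(\<lambda>j. (x (Suc k) - x (r j + Suc i)) \<bullet> (v k - v (r j + i)))
        \<longlonglongrightarrow> (x (Suc k) - (l - real (Suc i) *\<^sub>R ?d)) \<bullet> (v k - w)"
      by (intro tendsto_intros conjunct1[OF shifted_limits[OF assms]]
          conjunct2[OF shifted_limits[OF assms]])
    then have "0 \<le> (x (Suc k) - (l - real (Suc i) *\<^sub>R ?d)) \<bullet> (v k - w)"
      by (rule tendsto_lowerbound) (use monotone[of k] in auto)
    then show ?thesis
      by (simp only: inner_diff_left inner_scaleR_left)
  qed
  show ?thesis
  proof (rule ccontr)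
    assume "\<not> ?thesis"
    then have pos: "0 < - (?d \<bullet> (v k - w))"
      by simp
    then obtain n where n: "(x (Suc k) - l) \<bullet> (v k - w) < real n * - (?d \<bullet> (v k - w))"
      using reals_Archimedean3 by blast
    then show False
      using ray[of n] pos by (simp add: algebra_simps)
  qed
qed

lemma v_limit:
  assumes "strict_mono r" "(\<lambda>j. x (r j)) \<longlonglongrightarrow> l" "(\<lambda>j. v (r j)) \<longlonglongrightarrow> w"
  shows "v \<longlonglongrightarrow> w"
proof (rule tendsto_if_unique_seq_limit_point[OF bounded_v])
  fix w' assume w': "seq_limit_point v w'"
  then obtain s where s: "(\<lambda>j. v (s j)) \<longlonglongrightarrow> w'"
    by (auto simp: seq_limit_point_def o_def)
  have "(\<lambda>j. dual_gradient w \<bullet> (v (s j) - w)) \<longlonglongrightarrow> dual_gradient w \<bullet> (w' - w)"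
    by (intro tendsto_intros s)
  then have "0 \<le> dual_gradient w \<bullet> (w' - w)"
    by (rule tendsto_lowerbound) (auto simp: recession_inequality[OF assms])
  moreover have "conjugate \<phi> w' = conjugate \<phi> w"
    using w' assms by (intro limit_points_conjugate_eq) (auto simp: seq_limit_point_def o_def)
  ultimately show "w' = w"
    using dual_gradient_subgradient_eq[of w' w] by simp
qed

text \<open>If \<open>v\<close> converges to \<open>w\<close> then the increments of \<open>x\<close> converge to \<open>- dual_gradient w\<close>, so
  \<open>x\<close> drifts off to infinity unless \<open>w = 0\<close>.\<close>

lemma v_tendsto_zero:
  assumes "seq_limit_point x l"
  shows "v \<longlonglongrightarrow> 0"
proof -
  obtain r where r: "strict_mono r" "(\<lambda>j. x (r j)) \<longlonglongrightarrow> l"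
    using assms by (auto simp: seq_limit_point_def o_def)
  have "bounded (range (v \<circ> r))"
    using bounded_v by (rule bounded_subset) auto
  then obtain w s where s: "strict_mono s" "((v \<circ> r) \<circ> s) \<longlonglongrightarrow> w"
    using bounded_imp_convergent_subsequence by blast
  define q where "q = r \<circ> s"
  have q: "strict_mono q" "(\<lambda>j. x (q j)) \<longlonglongrightarrow> l" "(\<lambda>j. v (q j)) \<longlonglongrightarrow> w"
    using r s LIMSEQ_subseq_LIMSEQ[OF r(2) s(1)] by (auto simp: q_def o_def strict_mono_def)
  have v: "v \<longlonglongrightarrow> w"
    using q by (rule v_limit)
  let ?d = "dual_gradient w"
  have "?d = 0"
  proof (rule ccontr)
    assume "?d \<noteq> 0"
    then have pos: "0 < ?d \<bullet> ?d / 2"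
      by simp
    have "(\<lambda>k. dual_gradient (v k) \<bullet> ?d) \<longlonglongrightarrow> ?d \<bullet> ?d"
      by (intro tendsto_intros v isCont_tendsto_compose[OF isCont_dual_gradient])
    then have "\<forall>\<^sub>F k in sequentially. ?d \<bullet> ?d / 2 < dual_gradient (v k) \<bullet> ?d"
      by (rule order_tendstoD) (use pos in simp)
    then obtain N where N: "\<And>k. N \<le> k \<Longrightarrow> ?d \<bullet> ?d / 2 < dual_gradient (v k) \<bullet> ?d"
      by (auto simp: eventually_sequentially)
    have drift: "x (N + n) \<bullet> ?d \<le> x N \<bullet> ?d - real n * (?d \<bullet> ?d / 2)" for n
    proof (induction n)
      case (Suc n)
      then show ?case
        using N[of "N + n"] by (simp add: step[of "N + n"] inner_diff_left algebra_simps add_divide_distrib)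
    qed simp
    have lim: "(\<lambda>j. x (q j) \<bullet> ?d) \<longlonglongrightarrow> l \<bullet> ?d"
      by (intro tendsto_intros q)
    obtain n where n: "x N \<bullet> ?d - (l \<bullet> ?d - 1) < real n * (?d \<bullet> ?d / 2)"
      using reals_Archimedean3[OF pos] by blast
    have "x k \<bullet> ?d \<le> l \<bullet> ?d - 1" if "N + n \<le> k" for k
    proof -
      have "real n * (?d \<bullet> ?d / 2) \<le> real (k - N) * (?d \<bullet> ?d / 2)"
        using that pos by (intro mult_right_mono) auto
      then show ?thesis
        using drift[of "k - N"] n that by simp
    qed
    then have "\<forall>\<^sub>F j in sequentially. x (q j) \<bullet> ?d \<le> l \<bullet> ?d - 1"
      using seq_suble[OF q(1)] by (intro eventually_sequentiallyI[of "N + n"]) (metis order_trans)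
    then have "l \<bullet> ?d \<le> l \<bullet> ?d - 1"
      using tendsto_upperbound[OF lim] by simp
    then show False
      by simp
  qed
  then have "w = 0"
    using dual_gradient_zero[OF gradient_zero] dual_gradient_inj[of w 0] by simp
  then show ?thesis
    using v by simp
qed

lemma successor_limit:
  assumes "strict_mono r" "(\<lambda>j. x (r j)) \<longlonglongrightarrow> l"
  shows "(\<lambda>j. x (Suc (r j))) \<longlonglongrightarrow> l \<and> (\<lambda>j. v (r j)) \<longlonglongrightarrow> 0"
proof
  have "v \<longlonglongrightarrow> 0"
    using assms by (intro v_tendsto_zero[of l]) (auto simp: seq_limit_point_def o_def)
  from LIMSEQ_subseq_LIMSEQ[OF this assms(1)] show v: "(\<lambda>j. v (r j)) \<longlonglongrightarrow> 0"
    by (simp add: o_def)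
  have "(\<lambda>j. x (r j) - dual_gradient (v (r j))) \<longlonglongrightarrow> l - dual_gradient 0"
    by (intro tendsto_intros assms v isCont_tendsto_compose[OF isCont_dual_gradient])
  then show "(\<lambda>j. x (Suc (r j))) \<longlonglongrightarrow> l"
    by (simp add: step dual_gradient_zero[OF gradient_zero])
qed

end

theorem theorem4p19:
  fixes \<phi> :: "'a::euclidean_space \<Rightarrow> real"
    and T :: "'a \<Rightarrow> 'a set"
    and x v :: "nat \<Rightarrow> 'a"
  assumes "strictly_convex \<phi>"
    and "smooth \<phi>"
    and "super_coercive \<phi>"
    and "gradient \<phi> 0 = 0"
    and "maximal_monotone T"
    and "\<And>k. v k \<in> T (x (Suc k))"
    and "\<And>k. x (Suc k) = x k - gradient (conjugate \<phi>) (v k)"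
  shows "((\<exists>l. seq_limit_point x l) \<longrightarrow> v \<longlonglongrightarrow> 0) \<and>
         (\<forall>l. seq_limit_point x l \<longrightarrow> 0 \<in> T l)"
proof -
  have T: "0 \<le> (y - z) \<bullet> (y' - z')" if "y' \<in> T y" "z' \<in> T z" for y y' z z'
    using assms(5) that by (fastforce simp: maximal_monotone_def monotone_map_def map_graph_def)
  interpret prox_function \<phi>
    using assms(1-3) by unfold_locales
  interpret anisotropic_ppa \<phi> x v
    using assms(4,6,7) T by unfold_locales (auto simp: gradient_conjugate)
  have "0 \<in> T l" if l: "seq_limit_point x l" for l
  proof (rule maximal_monotoneD[OF assms(5)])
    fix y y' assume y: "y' \<in> T y"
    obtain r where r: "strict_mono r" "(\<lambda>j. x (r j)) \<longlonglongrightarrow> l"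
      using l by (auto simp: seq_limit_point_def o_def)
    have "(\<lambda>j. (y - x (Suc (r j))) \<bullet> (y' - v (r j))) \<longlonglongrightarrow> (y - l) \<bullet> (y' - 0)"
      using successor_limit[OF r] by (intro tendsto_intros) auto
    then show "0 \<le> (y - l) \<bullet> (y' - 0)"
      by (rule tendsto_lowerbound) (auto simp: T y assms(6))
  qed
  then show ?thesis
    using v_tendsto_zero by blast
qed

end
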